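(* Let $I=[0,1]$, let $T:I\to I$ be a $C^1$ map with $|T'(x)|\le\lambda<1$ for all $x\in I$, and let $a\in I$ be the unique fixed point of $T$. Let $\alpha\in(0,1)$, let $\mathcal B^\alpha=(C^\alpha(I))^*$ with norm $\|\cdot\|_\alpha$, and let $\mathcal L:\mathcal B^\alpha\to\mathcal B^\alpha$ be the transfer operator $\mathcal L\mu(\varphi)=\mu(\varphi\circ T)$. Then $\mathcal L$ acting on $\mathcal B^\alpha$ has a spectral gap: $1$ is a simple eigenvalue and the rest of the spectrum is contained in a disk $\{|z|\le r\}$ of radius $r<1$. Consequently the point mass $\delta_a$ is (up to scalar multiples) the only invariant distribution, i.e. the only $\mu\in\mathcal B^\alpha$ with $\mathcal L\mu=\mu$, and for any $\mu\in\mathcal B^\alpha$ with $\mu(1)=1$, $\mathcal L^n\mu$ converges to $\delta_a$ at an exponential rate in $\|\cdot\|_\alpha$.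
   Context: $C^\alpha(I)$ is the space of $\alpha$-Hölder functions on $I$ with norm $|\varphi|_{C^\alpha}=\sup_I|\varphi|+H^\alpha(\varphi)$, $H^\alpha(\varphi)=\sup_{x\ne y}|\varphi(x)-\varphi(y)|/|x-y|^\alpha$. For $\mu\in(C^\alpha(I))^*$, $\|\mu\|_\alpha=\sup\{\mu(\varphi):\varphi\in C^\alpha(I),\ |\varphi|_{C^\alpha}\le1\}$. Elements of $\mathcal B^\alpha$ are called distributions; finite Borel measures on $I$ (in particular $\delta_a$) are identified with elements of $\mathcal B^\alpha$ by integration. $\mu(1)$ denotes $\mu$ applied to the constant function $1$. As usual, spectra of operators refer to complexifications. *)

theory Defs
  imports "HOL-Probability.Probability"
begin

section \<open>Hoelder functions on the unit interval and their dual\<close>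

abbreviation unit_I :: "real set" where
  "unit_I \<equiv> {0..1}"

text \<open>
  A function on the unit interval is represented by any function on the reals that restricts to it.
  The Hoelder norm below only sees the restriction, so it is a seminorm on the representatives, and
  a functional that is linear and bounded for it automatically depends on the restriction only.
\<close>

definition holder_quotients :: "real \<Rightarrow> (real \<Rightarrow> real) \<Rightarrow> real set" where
  "holder_quotients \<alpha> \<phi> =
     {\<bar>\<phi> x - \<phi> y\<bar> / \<bar>x - y\<bar> powr \<alpha> | x y. x \<in> unit_I \<and> y \<in> unit_I \<and> x \<noteq> y}"

definition holder_space :: "real \<Rightarrow> (real \<Rightarrow> real) set" where
  "holder_space \<alpha> = {\<phi>. bdd_above (holder_quotients \<alpha> \<phi>)}"

definition holder_norm :: "real \<Rightarrow> (real \<Rightarrow> real) \<Rightarrow> real" where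
  "holder_norm \<alpha> \<phi> = (SUP x\<in>unit_I. \<bar>\<phi> x\<bar>) + Sup (holder_quotients \<alpha> \<phi>)"

text \<open>
  A distribution is set to zero outside the Hoelder space, so that two distributions are equal as
  elements of the dual iff they are equal as HOL functions.
\<close>

definition distributions :: "real \<Rightarrow> ((real \<Rightarrow> real) \<Rightarrow> real) set" where
  "distributions \<alpha> =
     {\<mu>. (\<forall>\<phi>\<in>holder_space \<alpha>. \<forall>\<psi>\<in>holder_space \<alpha>. \<mu> (\<lambda>x. \<phi> x + \<psi> x) = \<mu> \<phi> + \<mu> \<psi>) \<and>
         (\<forall>c. \<forall>\<phi>\<in>holder_space \<alpha>. \<mu> (\<lambda>x. c * \<phi> x) = c * \<mu> \<phi>) \<and>
         (\<exists>K. \<forall>\<phi>\<in>holder_space \<alpha>. \<bar>\<mu> \<phi>\<bar> \<le> K * holder_norm \<alpha> \<phi>) \<and>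
         (\<forall>\<phi>. \<phi> \<notin> holder_space \<alpha> \<longrightarrow> \<mu> \<phi> = 0)}"

definition distribution_norm :: "real \<Rightarrow> ((real \<Rightarrow> real) \<Rightarrow> real) \<Rightarrow> real" where
  "distribution_norm \<alpha> \<mu> = Sup {\<mu> \<phi> | \<phi>. \<phi> \<in> holder_space \<alpha> \<and> holder_norm \<alpha> \<phi> \<le> 1}"

definition distribution_of_measure :: "real \<Rightarrow> real measure \<Rightarrow> (real \<Rightarrow> real) \<Rightarrow> real" where
  "distribution_of_measure \<alpha> M = (\<lambda>\<phi>. if \<phi> \<in> holder_space \<alpha> then (\<integral>x. \<phi> x \<partial>M) else 0)"

definition point_mass :: "real \<Rightarrow> real \<Rightarrow> (real \<Rightarrow> real) \<Rightarrow> real" where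
  "point_mass \<alpha> a = distribution_of_measure \<alpha> (return (restrict_space borel unit_I) a)"

definition transfer_operator ::
    "real \<Rightarrow> (real \<Rightarrow> real) \<Rightarrow> ((real \<Rightarrow> real) \<Rightarrow> real) \<Rightarrow> (real \<Rightarrow> real) \<Rightarrow> real" where
  "transfer_operator \<alpha> T \<mu> = (\<lambda>\<phi>. if \<phi> \<in> holder_space \<alpha> then \<mu> (\<phi> \<circ> T) else 0)"

section \<open>Spectra of operators on real normed spaces\<close>

text \<open>
  In this section \<open>V\<close> is the carrier of a real vector space of real-valued functions with pointwise
  operations, \<open>N\<close> a norm on \<open>V\<close> and \<open>A\<close> a linear operator on \<open>V\<close>. The element
  \<open>u + i v\<close> of the complexification is the complex-valued function with real part \<open>u\<close> and
  imaginary part \<open>v\<close>.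
\<close>

definition cx_space :: "('b \<Rightarrow> real) set \<Rightarrow> ('b \<Rightarrow> complex) set" where
  "cx_space V = {M. (\<lambda>x. Re (M x)) \<in> V \<and> (\<lambda>x. Im (M x)) \<in> V}"

text \<open>
  The Taylor norm, the supremum over \<open>t\<close> of the norms of \<open>u cos t - v sin t\<close>. It is
  equivalent to the norm \<open>N u + N v\<close>, so boundedness does not depend on this choice.
\<close>

definition cx_norm :: "(('b \<Rightarrow> real) \<Rightarrow> real) \<Rightarrow> ('b \<Rightarrow> complex) \<Rightarrow> real" where
  "cx_norm N M = (SUP t. N (\<lambda>x. Re (cis t * M x)))"

definition cx_operator ::
    "(('b \<Rightarrow> real) \<Rightarrow> ('b \<Rightarrow> real)) \<Rightarrow> ('b \<Rightarrow> complex) \<Rightarrow> ('b \<Rightarrow> complex)" where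
  "cx_operator A M = (\<lambda>x. Complex (A (\<lambda>y. Re (M y)) x) (A (\<lambda>y. Im (M y)) x))"

definition cx_shift ::
    "(('b \<Rightarrow> real) \<Rightarrow> ('b \<Rightarrow> real)) \<Rightarrow> complex \<Rightarrow> ('b \<Rightarrow> complex) \<Rightarrow> ('b \<Rightarrow> complex)" where
  "cx_shift A z M = (\<lambda>x. cx_operator A M x - z * M x)"

text \<open>Linearity of \<open>R\<close> need not be required: a two-sided inverse of a linear map is linear.\<close>

definition spectrum ::
    "('b \<Rightarrow> real) set \<Rightarrow> (('b \<Rightarrow> real) \<Rightarrow> real) \<Rightarrow> (('b \<Rightarrow> real) \<Rightarrow> ('b \<Rightarrow> real)) \<Rightarrow> complex set" where
  "spectrum V N A = {z. \<not> (\<exists>R.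
     (\<forall>M\<in>cx_space V. R M \<in> cx_space V \<and> R (cx_shift A z M) = M \<and> cx_shift A z (R M) = M) \<and>
     (\<exists>K. \<forall>M\<in>cx_space V. cx_norm N (R M) \<le> K * cx_norm N M))}"

text \<open>
  Simple means algebraically simple. The generalized eigenspace is a line; since in infinite
  dimensions the algebraic multiplicity of an isolated point of the spectrum is the rank of its
  spectral projection, we also ask that the range of \<open>A - z\<close> complements this line. (The generalized
  eigenspace alone does not see a summand on which \<open>A - z\<close> is injective and quasinilpotent.)
\<close>

definition simple_eigenvalue ::
    "('b \<Rightarrow> real) set \<Rightarrow> (('b \<Rightarrow> real) \<Rightarrow> ('b \<Rightarrow> real)) \<Rightarrow> complex \<Rightarrow> bool" where
  "simple_eigenvalue V A z \<longleftrightarrow> (\<exists>v\<in>cx_space V.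
     v \<noteq> (\<lambda>_. 0) \<and> cx_shift A z v = (\<lambda>_. 0) \<and>
     {M \<in> cx_space V. \<exists>k. (cx_shift A z ^^ k) M = (\<lambda>_. 0)} = range (\<lambda>c x. c * v x) \<and>
     (\<forall>M\<in>cx_space V. \<exists>c. \<exists>M'\<in>cx_space V. M = (\<lambda>x. c * v x + cx_shift A z M' x)))"

definition spectral_gap ::
    "('b \<Rightarrow> real) set \<Rightarrow> (('b \<Rightarrow> real) \<Rightarrow> real) \<Rightarrow> (('b \<Rightarrow> real) \<Rightarrow> ('b \<Rightarrow> real)) \<Rightarrow> bool" where
  "spectral_gap V N A \<longleftrightarrow>
     simple_eigenvalue V A 1 \<and>
     (\<exists>r::real. 0 \<le> r \<and> r < 1 \<and> spectrum V N A - {1} \<subseteq> {z. cmod z \<le> r})"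

end

theory Submission
  imports Defs
begin

text \<open>
  Since \<open>T\<close> contracts by \<open>lam\<close>, a Hoelder function satisfies
  \<open>\<parallel>\<phi> \<circ> T\<^sup>n - \<phi>(a)\<parallel> \<le> 2 s\<^sup>n \<parallel>\<phi>\<parallel>\<close> with \<open>s = lam\<^sup>\<alpha> < 1\<close>. By duality,
  \<open>L\<^sup>n \<mu> - \<mu>(1) \<delta>\<^sub>a\<close> decays like \<open>s\<^sup>n\<close>. Hence the Neumann series
  \<open>S\<^sub>z \<mu> = \<Sum>n. z\<^sup>-\<^sup>n\<^sup>-\<^sup>1 (L\<^sup>n \<mu> - \<mu>(1) \<delta>\<^sub>a)\<close> converges for \<open>\<bar>z\<bar> > s\<close>, and telescoping gives
  \<open>(L - z) S\<^sub>z \<mu> = \<mu>(1) \<delta>\<^sub>a - \<mu>\<close>. For \<open>z \<noteq> 1\<close> the resolvent is therefore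
  \<open>\<mu> \<mapsto> \<mu>(1) \<delta>\<^sub>a / (1 - z) - S\<^sub>z \<mu>\<close>, and for \<open>z = 1\<close> the identity shows that the range of
  \<open>L - 1\<close> complements the line spanned by \<open>\<delta>\<^sub>a\<close>.
\<close>

section \<open>Hoelder functions\<close>

lemma holder_quotientsI:
  "x \<in> unit_I \<Longrightarrow> y \<in> unit_I \<Longrightarrow> x \<noteq> y \<Longrightarrow> \<bar>\<phi> x - \<phi> y\<bar> / \<bar>x - y\<bar> powr \<alpha> \<in> holder_quotients \<alpha> \<phi>"
  unfolding holder_quotients_def by blast

text \<open>A Hoelder estimate with constant \<open>B\<close> bounds every difference quotient by
  \<open>B\<close>, so membership and the bound on the seminorm come together.\<close>

lemma holder_spaceI:
  assumes "\<And>x y. x \<in> unit_I \<Longrightarrow> y \<in> unit_I \<Longrightarrow> \<bar>\<phi> x - \<phi> y\<bar> \<le> B * \<bar>x - y\<bar> powr \<alpha>"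
  shows "\<phi> \<in> holder_space \<alpha>" and "Sup (holder_quotients \<alpha> \<phi>) \<le> B"
proof -
  have le: "q \<le> B" if "q \<in> holder_quotients \<alpha> \<phi>" for q
    using that assms by (auto simp: holder_quotients_def divide_le_eq)
  then show "\<phi> \<in> holder_space \<alpha>"
    by (auto simp: holder_space_def intro!: bdd_aboveI)
  \<comment> \<open>An upper bound controls a real supremum only over a nonempty set; the points 0
    and 1 supply a quotient.\<close>
  have "holder_quotients \<alpha> \<phi> \<noteq> {}"
    using holder_quotientsI[of 0 1 \<phi> \<alpha>] by auto
  then show "Sup (holder_quotients \<alpha> \<phi>) \<le> B"
    using le by (rule cSup_least)
qed

lemma holder_norm_le:
  assumes "\<And>x. x \<in> unit_I \<Longrightarrow> \<bar>\<phi> x\<bar> \<le> A"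
    and "\<And>x y. x \<in> unit_I \<Longrightarrow> y \<in> unit_I \<Longrightarrow> \<bar>\<phi> x - \<phi> y\<bar> \<le> B * \<bar>x - y\<bar> powr \<alpha>"
  shows "holder_norm \<alpha> \<phi> \<le> A + B"
  unfolding holder_norm_def
  using assms by (intro add_mono cSUP_least holder_spaceI) auto

lemma holder_quotients_Sup_nonneg:
  assumes "\<phi> \<in> holder_space \<alpha>"
  shows "0 \<le> Sup (holder_quotients \<alpha> \<phi>)"
proof -
  have "\<bar>\<phi> 0 - \<phi> 1\<bar> / \<bar>0 - 1\<bar> powr \<alpha> \<in> holder_quotients \<alpha> \<phi>"
    by (rule holder_quotientsI) auto
  then have "\<bar>\<phi> 0 - \<phi> 1\<bar> / \<bar>0 - 1\<bar> powr \<alpha> \<le> Sup (holder_quotients \<alpha> \<phi>)"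
    using assms by (intro cSup_upper) (auto simp: holder_space_def)
  moreover have "0 \<le> \<bar>\<phi> 0 - \<phi> 1\<bar> / \<bar>0 - 1\<bar> powr \<alpha>"
    by simp
  ultimately show ?thesis
    by linarith
qed

lemma holder_space_diff_le:
  assumes "\<phi> \<in> holder_space \<alpha>" "x \<in> unit_I" "y \<in> unit_I"
  shows "\<bar>\<phi> x - \<phi> y\<bar> \<le> Sup (holder_quotients \<alpha> \<phi>) * \<bar>x - y\<bar> powr \<alpha>"
proof (cases "x = y")
  case False
  have "\<bar>\<phi> x - \<phi> y\<bar> / \<bar>x - y\<bar> powr \<alpha> \<in> holder_quotients \<alpha> \<phi>"
    using assms(2,3) False by (rule holder_quotientsI)
  then have "\<bar>\<phi> x - \<phi> y\<bar> / \<bar>x - y\<bar> powr \<alpha> \<le> Sup (holder_quotients \<alpha> \<phi>)"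
    using assms by (intro cSup_upper) (auto simp: holder_space_def)
  then show ?thesis
    using False by (simp add: divide_le_eq)
qed simp

lemma powr_le_one_on_unit:
  fixes x y \<alpha> :: real
  assumes "0 < \<alpha>" "x \<in> unit_I" "y \<in> unit_I"
  shows "\<bar>x - y\<bar> powr \<alpha> \<le> 1"
  using powr_mono2[of \<alpha> "\<bar>x - y\<bar>" 1] assms by auto

text \<open>The supremum is known to dominate the values only once they are bounded above.
  Comparison with the value at 0 gives such a bound, because distances in the interval are at most
  1.\<close>

lemma holder_space_sup_le:
  assumes "0 < \<alpha>" "\<phi> \<in> holder_space \<alpha>" "x \<in> unit_I"
  shows "\<bar>\<phi> x\<bar> \<le> (SUP x\<in>unit_I. \<bar>\<phi> x\<bar>)"
proof (rule cSUP_upper[OF assms(3)])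
  let ?H = "Sup (holder_quotients \<alpha> \<phi>)"
  have "\<bar>\<phi> y\<bar> \<le> \<bar>\<phi> 0\<bar> + ?H" if "y \<in> unit_I" for y
  proof -
    have "\<bar>\<phi> y - \<phi> 0\<bar> \<le> ?H * \<bar>y - 0\<bar> powr \<alpha>"
      using assms that by (intro holder_space_diff_le) auto
    also have "\<dots> \<le> ?H * 1"
      using assms that powr_le_one_on_unit[of \<alpha> y 0]
      by (intro mult_left_mono holder_quotients_Sup_nonneg) auto
    finally show ?thesis
      by linarith
  qed
  then show "bdd_above ((\<lambda>x. \<bar>\<phi> x\<bar>) ` unit_I)"
    by (rule bdd_aboveI2)
qed

lemma abs_le_holder_norm:
  assumes "0 < \<alpha>" "\<phi> \<in> holder_space \<alpha>" "x \<in> unit_I"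
  shows "\<bar>\<phi> x\<bar> \<le> holder_norm \<alpha> \<phi>"
  using holder_space_sup_le[OF assms] holder_quotients_Sup_nonneg[OF assms(2)]
  unfolding holder_norm_def by linarith

lemma holder_norm_nonneg:
  assumes "0 < \<alpha>" "\<phi> \<in> holder_space \<alpha>"
  shows "0 \<le> holder_norm \<alpha> \<phi>"
  using abs_le_holder_norm[OF assms, of 0] by simp

lemma Sup_le_holder_norm:
  assumes "0 < \<alpha>" "\<phi> \<in> holder_space \<alpha>"
  shows "Sup (holder_quotients \<alpha> \<phi>) \<le> holder_norm \<alpha> \<phi>"
  using holder_space_sup_le[OF assms, of 0] abs_ge_zero[of "\<phi> 0"] unfolding holder_norm_def by simp

lemma holder_space_const: "(\<lambda>_. c) \<in> holder_space \<alpha>"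
  by (rule holder_spaceI[where B = 0]) simp

lemma holder_space_add:
  assumes "\<phi> \<in> holder_space \<alpha>" "\<psi> \<in> holder_space \<alpha>"
  shows "(\<lambda>x. \<phi> x + \<psi> x) \<in> holder_space \<alpha>"
proof (rule holder_spaceI)
  fix x y :: real assume "x \<in> unit_I" "y \<in> unit_I"
  then show "\<bar>\<phi> x + \<psi> x - (\<phi> y + \<psi> y)\<bar> \<le>
      (Sup (holder_quotients \<alpha> \<phi>) + Sup (holder_quotients \<alpha> \<psi>)) * \<bar>x - y\<bar> powr \<alpha>"
    using holder_space_diff_le[OF assms(1), of x y] holder_space_diff_le[OF assms(2), of x y]
    unfolding distrib_right by linarith
qed

lemma holder_scale_diff_le:
  assumes "\<phi> \<in> holder_space \<alpha>" "x \<in> unit_I" "y \<in> unit_I"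
  shows "\<bar>c * \<phi> x - c * \<phi> y\<bar> \<le> \<bar>c\<bar> * Sup (holder_quotients \<alpha> \<phi>) * \<bar>x - y\<bar> powr \<alpha>"
proof -
  have "\<bar>c * \<phi> x - c * \<phi> y\<bar> = \<bar>c\<bar> * \<bar>\<phi> x - \<phi> y\<bar>"
    by (simp add: abs_mult right_diff_distrib[symmetric])
  then show ?thesis
    using mult_left_mono[OF holder_space_diff_le[OF assms], of "\<bar>c\<bar>"] by (simp add: mult.assoc)
qed

lemma holder_space_scale:
  assumes "\<phi> \<in> holder_space \<alpha>"
  shows "(\<lambda>x. c * \<phi> x) \<in> holder_space \<alpha>"
  using holder_scale_diff_le[OF assms] by (rule holder_spaceI)

text \<open>This half of homogeneity is what \<open>cmod_le_cx_norm\<close> needs to normalise a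
  test function.\<close>

lemma holder_norm_scale_le:
  assumes "0 < \<alpha>" "\<phi> \<in> holder_space \<alpha>"
  shows "holder_norm \<alpha> (\<lambda>x. c * \<phi> x) \<le> \<bar>c\<bar> * holder_norm \<alpha> \<phi>"
proof -
  have "holder_norm \<alpha> (\<lambda>x. c * \<phi> x) \<le>
      \<bar>c\<bar> * (SUP x\<in>unit_I. \<bar>\<phi> x\<bar>) + \<bar>c\<bar> * Sup (holder_quotients \<alpha> \<phi>)"
    using holder_space_sup_le[OF assms] holder_scale_diff_le[OF assms(2)]
    by (intro holder_norm_le) (auto simp: abs_mult intro!: mult_left_mono)
  then show ?thesis
    by (simp add: holder_norm_def distrib_left)
qed

text \<open>Continuity provides the measurability with which the integral defining the point mass is
  evaluated. It holds because \<open>\<bar>x - y\<bar> powr \<alpha>\<close> tends to 0 as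
  \<open>x\<close> tends to \<open>y\<close>.\<close>

lemma continuous_on_holder_space:
  assumes "0 < \<alpha>" "\<phi> \<in> holder_space \<alpha>"
  shows "continuous_on unit_I \<phi>"
  unfolding continuous_on_def
proof
  fix y :: real assume y: "y \<in> unit_I"
  let ?H = "Sup (holder_quotients \<alpha> \<phi>)"
  have "((\<lambda>x. \<bar>x - y\<bar>) \<longlongrightarrow> 0) (at y within unit_I)"
    by (auto intro!: tendsto_eq_intros)
  then have "((\<lambda>x. \<bar>x - y\<bar> powr \<alpha>) \<longlongrightarrow> 0 powr \<alpha>) (at y within unit_I)"
    using assms(1) by (intro tendsto_powr') (auto simp: eventually_at_filter)
  then have "((\<lambda>x. ?H * \<bar>x - y\<bar> powr \<alpha>) \<longlongrightarrow> 0) (at y within unit_I)"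
    using tendsto_mult_right_zero by fastforce
  moreover have "\<forall>\<^sub>F x in at y within unit_I. norm (\<phi> x - \<phi> y) \<le> ?H * \<bar>x - y\<bar> powr \<alpha>"
    using holder_space_diff_le[OF assms(2) _ y] by (auto simp: eventually_at_filter)
  ultimately have "((\<lambda>x. \<phi> x - \<phi> y) \<longlongrightarrow> 0) (at y within unit_I)"
    by (rule Lim_null_comparison[rotated])
  then show "(\<phi> \<longlongrightarrow> \<phi> y) (at y within unit_I)"
    by (rule LIM_zero_cancel)
qed

text \<open>Integration against a Dirac measure is evaluation. The measure lives on the restricted
  Borel space, so the integrand has to be measurable on the interval only, and the arbitrary values
  of a representative elsewhere do no harm.\<close>

lemma point_mass_eq:
  assumes "0 < \<alpha>" "a \<in> unit_I"
  shows "point_mass \<alpha> a \<phi> = (if \<phi> \<in> holder_space \<alpha> then \<phi> a else 0)"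
  using assms
  by (auto simp: point_mass_def distribution_of_measure_def space_restrict_space
      intro!: integral_return borel_measurable_continuous_on_restrict continuous_on_holder_space)

section \<open>Functionals on the Hoelder space\<close>

text \<open>
  Allowing values in any normed space treats distributions and elements of their
  complexification (complex-valued real-linear functionals) at once.
\<close>

definition holder_functional ::
    "real \<Rightarrow> ((real \<Rightarrow> real) \<Rightarrow> 'b::real_normed_vector) \<Rightarrow> bool" where
  "holder_functional \<alpha> F \<longleftrightarrow>
     (\<forall>\<phi>\<in>holder_space \<alpha>. \<forall>\<psi>\<in>holder_space \<alpha>. F (\<lambda>x. \<phi> x + \<psi> x) = F \<phi> + F \<psi>) \<and>
     (\<forall>c. \<forall>\<phi>\<in>holder_space \<alpha>. F (\<lambda>x. c * \<phi> x) = c *\<^sub>R F \<phi>) \<and>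
     (\<exists>K. \<forall>\<phi>\<in>holder_space \<alpha>. norm (F \<phi>) \<le> K * holder_norm \<alpha> \<phi>) \<and>
     (\<forall>\<phi>. \<phi> \<notin> holder_space \<alpha> \<longrightarrow> F \<phi> = 0)"

lemma holder_functionalI:
  assumes "\<And>\<phi> \<psi>. \<phi> \<in> holder_space \<alpha> \<Longrightarrow> \<psi> \<in> holder_space \<alpha> \<Longrightarrow> F (\<lambda>x. \<phi> x + \<psi> x) = F \<phi> + F \<psi>"
    and "\<And>c \<phi>. \<phi> \<in> holder_space \<alpha> \<Longrightarrow> F (\<lambda>x. c * \<phi> x) = c *\<^sub>R F \<phi>"
    and "\<And>\<phi>. \<phi> \<in> holder_space \<alpha> \<Longrightarrow> norm (F \<phi>) \<le> K * holder_norm \<alpha> \<phi>"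
    and "\<And>\<phi>. \<phi> \<notin> holder_space \<alpha> \<Longrightarrow> F \<phi> = 0"
  shows "holder_functional \<alpha> F"
  using assms unfolding holder_functional_def by blast

lemma holder_functional_add:
  "holder_functional \<alpha> F \<Longrightarrow> \<phi> \<in> holder_space \<alpha> \<Longrightarrow> \<psi> \<in> holder_space \<alpha> \<Longrightarrow>
    F (\<lambda>x. \<phi> x + \<psi> x) = F \<phi> + F \<psi>"
  unfolding holder_functional_def by blast

lemma holder_functional_scale:
  "holder_functional \<alpha> F \<Longrightarrow> \<phi> \<in> holder_space \<alpha> \<Longrightarrow> F (\<lambda>x. c * \<phi> x) = c *\<^sub>R F \<phi>"
  unfolding holder_functional_def by blast

lemma holder_functional_outside:
  "holder_functional \<alpha> F \<Longrightarrow> \<phi> \<notin> holder_space \<alpha> \<Longrightarrow> F \<phi> = 0"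
  unfolding holder_functional_def by blast

text \<open>The constant in the definition may have either sign. Since \<open>holder_norm\<close> is
  nonnegative, the absolute value of the constant serves too, and later estimates rely on the sign
  when they multiply inequalities by it.\<close>

lemma holder_functional_bound:
  assumes "0 < \<alpha>" "holder_functional \<alpha> F"
  obtains K where "0 \<le> K" "\<And>\<phi>. \<phi> \<in> holder_space \<alpha> \<Longrightarrow> norm (F \<phi>) \<le> K * holder_norm \<alpha> \<phi>"
proof -
  obtain K where K: "\<And>\<phi>. \<phi> \<in> holder_space \<alpha> \<Longrightarrow> norm (F \<phi>) \<le> K * holder_norm \<alpha> \<phi>"
    using assms(2) unfolding holder_functional_def by blast
  have "norm (F \<phi>) \<le> \<bar>K\<bar> * holder_norm \<alpha> \<phi>" if "\<phi> \<in> holder_space \<alpha>" for \<phi>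
    using K[OF that] mult_right_mono[OF abs_ge_self[of K] holder_norm_nonneg[OF assms(1) that]]
    by linarith
  then show ?thesis
    using that[of "\<bar>K\<bar>"] by simp
qed

lemma holder_functional_diff:
  assumes "0 < \<alpha>" "holder_functional \<alpha> F" "holder_functional \<alpha> G"
  shows "holder_functional \<alpha> (\<lambda>\<phi>. F \<phi> - G \<phi>)"
proof -
  obtain K where K: "\<And>\<phi>. \<phi> \<in> holder_space \<alpha> \<Longrightarrow> norm (F \<phi>) \<le> K * holder_norm \<alpha> \<phi>"
    using holder_functional_bound[OF assms(1,2)] by blast
  obtain L where L: "\<And>\<phi>. \<phi> \<in> holder_space \<alpha> \<Longrightarrow> norm (G \<phi>) \<le> L * holder_norm \<alpha> \<phi>"
    using holder_functional_bound[OF assms(1,3)] by blast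
  show ?thesis
  proof (rule holder_functionalI)
    fix \<phi> assume "\<phi> \<in> holder_space \<alpha>"
    then show "norm (F \<phi> - G \<phi>) \<le> (K + L) * holder_norm \<alpha> \<phi>"
      using K[of \<phi>] L[of \<phi>] norm_triangle_ineq4[of "F \<phi>" "G \<phi>"] unfolding distrib_right by linarith
  qed (simp_all add: holder_functional_add[OF assms(2)] holder_functional_add[OF assms(3)]
      holder_functional_scale[OF assms(2)] holder_functional_scale[OF assms(3)]
      holder_functional_outside[OF assms(2)] holder_functional_outside[OF assms(3)]
      scaleR_right_diff_distrib)
qed

lemma holder_functional_cmult:
  fixes F :: "(real \<Rightarrow> real) \<Rightarrow> 'b::real_normed_algebra"
  assumes "0 < \<alpha>" "holder_functional \<alpha> F"
  shows "holder_functional \<alpha> (\<lambda>\<phi>. c * F \<phi>)"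
proof -
  obtain K where K: "\<And>\<phi>. \<phi> \<in> holder_space \<alpha> \<Longrightarrow> norm (F \<phi>) \<le> K * holder_norm \<alpha> \<phi>"
    using holder_functional_bound[OF assms] by blast
  show ?thesis
  proof (rule holder_functionalI)
    fix \<phi> assume "\<phi> \<in> holder_space \<alpha>"
    then have "norm c * norm (F \<phi>) \<le> norm c * (K * holder_norm \<alpha> \<phi>)"
      using K by (intro mult_left_mono) auto
    then show "norm (c * F \<phi>) \<le> (norm c * K) * holder_norm \<alpha> \<phi>"
      using norm_mult_ineq[of c "F \<phi>"] by (simp add: mult.assoc)
  qed (simp_all add: holder_functional_add[OF assms(2)] holder_functional_scale[OF assms(2)]
      holder_functional_outside[OF assms(2)] distrib_left)
qed

section \<open>Distributions, their complexification and the dual norms\<close>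

lemma distributions_iff: "\<mu> \<in> distributions \<alpha> \<longleftrightarrow> holder_functional \<alpha> \<mu>"
  by (simp add: distributions_def holder_functional_def)

text \<open>Boundedness passes between a complex functional and its two parts because the modulus
  dominates each part and is at most the sum of their absolute values. Elements of the
  complexification can then be treated without splitting them.\<close>

lemma cx_space_distributions_iff:
  assumes "0 < \<alpha>"
  shows "M \<in> cx_space (distributions \<alpha>) \<longleftrightarrow> holder_functional \<alpha> M"
proof
  assume "M \<in> cx_space (distributions \<alpha>)"
  then have R: "holder_functional \<alpha> (\<lambda>\<phi>. Re (M \<phi>))" and I: "holder_functional \<alpha> (\<lambda>\<phi>. Im (M \<phi>))"
    by (simp_all add: cx_space_def distributions_iff)
  obtain K where K: "\<And>\<phi>. \<phi> \<in> holder_space \<alpha> \<Longrightarrow> norm (Re (M \<phi>)) \<le> K * holder_norm \<alpha> \<phi>"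
    using holder_functional_bound[OF assms R] by blast
  obtain L where L: "\<And>\<phi>. \<phi> \<in> holder_space \<alpha> \<Longrightarrow> norm (Im (M \<phi>)) \<le> L * holder_norm \<alpha> \<phi>"
    using holder_functional_bound[OF assms I] by blast
  show "holder_functional \<alpha> M"
  proof (rule holder_functionalI)
    fix \<phi> assume "\<phi> \<in> holder_space \<alpha>"
    then show "norm (M \<phi>) \<le> (K + L) * holder_norm \<alpha> \<phi>"
      using K[of \<phi>] L[of \<phi>] cmod_le[of "M \<phi>"] unfolding distrib_right by simp
  qed (simp_all add: complex_eq_iff holder_functional_add[OF R] holder_functional_add[OF I]
      holder_functional_scale[OF R] holder_functional_scale[OF I]
      holder_functional_outside[OF R] holder_functional_outside[OF I])
next
  assume M: "holder_functional \<alpha> M"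
  obtain K where K: "\<And>\<phi>. \<phi> \<in> holder_space \<alpha> \<Longrightarrow> norm (M \<phi>) \<le> K * holder_norm \<alpha> \<phi>"
    using holder_functional_bound[OF assms M] by blast
  have "holder_functional \<alpha> (\<lambda>\<phi>. Re (M \<phi>))" "holder_functional \<alpha> (\<lambda>\<phi>. Im (M \<phi>))"
    using K order_trans[OF abs_Re_le_cmod] order_trans[OF abs_Im_le_cmod]
    by (auto intro!: holder_functionalI[where K = K] simp: holder_functional_add[OF M]
        holder_functional_scale[OF M] holder_functional_outside[OF M])
  then show "M \<in> cx_space (distributions \<alpha>)"
    by (simp add: cx_space_def distributions_iff)
qed

lemma distribution_norm_le:
  assumes "0 < \<alpha>" "0 \<le> C" "\<And>\<phi>. \<phi> \<in> holder_space \<alpha> \<Longrightarrow> \<mu> \<phi> \<le> C * holder_norm \<alpha> \<phi>"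
  shows "distribution_norm \<alpha> \<mu> \<le> C"
  unfolding distribution_norm_def
proof (rule cSup_least)
  \<comment> \<open>The zero function shows that the unit ball, hence the set under the supremum, is
    nonempty.\<close>
  have "holder_norm \<alpha> (\<lambda>_. 0) \<le> 0 + 0"
    by (rule holder_norm_le) auto
  then show "{\<mu> \<phi> |\<phi>. \<phi> \<in> holder_space \<alpha> \<and> holder_norm \<alpha> \<phi> \<le> 1} \<noteq> {}"
    using holder_space_const[of 0 \<alpha>] by auto
next
  fix q assume "q \<in> {\<mu> \<phi> |\<phi>. \<phi> \<in> holder_space \<alpha> \<and> holder_norm \<alpha> \<phi> \<le> 1}"
  then obtain \<phi> where \<phi>: "q = \<mu> \<phi>" "\<phi> \<in> holder_space \<alpha>" "holder_norm \<alpha> \<phi> \<le> 1"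
    by blast
  then show "q \<le> C"
    using assms(3)[of \<phi>] mult_left_mono[OF \<phi>(3) assms(2)] by simp
qed

lemma Re_cis_mult_le: "Re (cis t * w) \<le> cmod w"
  using complex_Re_le_cmod[of "cis t * w"] by (simp add: norm_mult)

lemma cx_norm_le:
  assumes "0 < \<alpha>" "0 \<le> C" "\<And>\<phi>. \<phi> \<in> holder_space \<alpha> \<Longrightarrow> cmod (M \<phi>) \<le> C * holder_norm \<alpha> \<phi>"
  shows "cx_norm (distribution_norm \<alpha>) M \<le> C"
  unfolding cx_norm_def
  using assms order_trans[OF Re_cis_mult_le] by (intro cSUP_least distribution_norm_le) blast+

text \<open>Conversely to \<open>cx_norm_le\<close>, the Taylor norm is itself an admissible
  constant: a suitable rotation turns a complex value into its modulus, and the supremum over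
  \<open>t\<close> includes that rotation. This makes bounds with an explicit constant uniform in
  \<open>M\<close>.\<close>

lemma cmod_le_cx_norm:
  assumes "0 < \<alpha>" "holder_functional \<alpha> M" "\<phi> \<in> holder_space \<alpha>"
  shows "cmod (M \<phi>) \<le> cx_norm (distribution_norm \<alpha>) M * holder_norm \<alpha> \<phi>"
proof -
  obtain K where K: "0 \<le> K" "\<And>\<phi>. \<phi> \<in> holder_space \<alpha> \<Longrightarrow> cmod (M \<phi>) \<le> K * holder_norm \<alpha> \<phi>"
    using holder_functional_bound[OF assms(1,2)] by blast
  have Re_le: "Re (cis t * M \<psi>) \<le> K * holder_norm \<alpha> \<psi>" if "\<psi> \<in> holder_space \<alpha>" for t \<psi>
    using K(2)[OF that] Re_cis_mult_le order_trans by blast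
  have unit: "cmod (M \<psi>) \<le> cx_norm (distribution_norm \<alpha>) M"
    if \<psi>: "\<psi> \<in> holder_space \<alpha>" "holder_norm \<alpha> \<psi> \<le> 1" for \<psi>
  proof -
    \<comment> \<open>Rotating by minus the argument makes the value at \<open>\<psi>\<close> real
      and equal to its modulus.\<close>
    let ?t = "- Arg (M \<psi>)"
    have "M \<psi> = of_real (cmod (M \<psi>)) * cis (Arg (M \<psi>))"
      using rcis_cmod_Arg[of "M \<psi>"] by (simp add: rcis_def)
    then have "cis ?t * M \<psi> = of_real (cmod (M \<psi>)) * (cis ?t * cis (Arg (M \<psi>)))"
      by (metis mult.left_commute)
    then have "cis ?t * M \<psi> = of_real (cmod (M \<psi>))"
      by (simp add: cis_mult)
    then have "cmod (M \<psi>) = Re (cis ?t * M \<psi>)"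
      by simp
    also have "\<dots> \<le> distribution_norm \<alpha> (\<lambda>x. Re (cis ?t * M x))"
      unfolding distribution_norm_def
    proof (rule cSup_upper)
      \<comment> \<open>The constant \<open>K\<close> is independent of the rotation, so it bounds
        both the supremum over the unit ball and the one over all \<open>t\<close>.\<close>
      have "Re (cis ?t * M \<eta>) \<le> K" if "\<eta> \<in> holder_space \<alpha>" "holder_norm \<alpha> \<eta> \<le> 1" for \<eta>
        using Re_le[OF that(1), of ?t] mult_left_mono[OF that(2) K(1)] by simp
      then show "bdd_above {Re (cis ?t * M \<phi>) |\<phi>. \<phi> \<in> holder_space \<alpha> \<and> holder_norm \<alpha> \<phi> \<le> 1}"
        by (intro bdd_aboveI[where M = K]) blast
    qed (use \<psi> in blast)
    also have "\<dots> \<le> cx_norm (distribution_norm \<alpha>) M"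
      unfolding cx_norm_def
      using distribution_norm_le[OF assms(1) K(1) Re_le]
      by (intro cSUP_upper bdd_aboveI2[where M = K]) auto
    finally show ?thesis .
  qed
  let ?n = "holder_norm \<alpha> \<phi>"
  have n0: "0 \<le> ?n"
    using holder_norm_nonneg assms by blast
  show ?thesis
  proof (cases "?n = 0")
    \<comment> \<open>The norm is only a seminorm on representatives, so it may vanish and forbid
      normalisation; the bound by \<open>K\<close> then forces the value to be 0.\<close>
    case True
    then show ?thesis
      using K(2)[OF assms(3)] by simp
  next
    case False
    then have n: "0 < ?n"
      using n0 by simp
    have "cmod (M (\<lambda>x. inverse ?n * \<phi> x)) \<le> cx_norm (distribution_norm \<alpha>) M"
      using holder_norm_scale_le[OF assms(1,3), of "inverse ?n"] n
      by (intro unit holder_space_scale assms) simp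
    then show ?thesis
      unfolding holder_functional_scale[OF assms(2,3)] using n by (simp add: field_simps)
  qed
qed

text \<open>The constant function 1 has positive norm, so testing on it reveals the sign.\<close>

lemma cx_norm_nonneg:
  assumes "0 < \<alpha>" "holder_functional \<alpha> M"
  shows "0 \<le> cx_norm (distribution_norm \<alpha>) M"
proof -
  have "1 \<le> holder_norm \<alpha> (\<lambda>_. 1)"
    using abs_le_holder_norm[OF assms(1) holder_space_const, of 0 1] by simp
  moreover have "0 \<le> cx_norm (distribution_norm \<alpha>) M * holder_norm \<alpha> (\<lambda>_. 1)"
    using cmod_le_cx_norm[OF assms holder_space_const[of 1]] norm_ge_zero order_trans by blast
  ultimately show ?thesis
    by (simp add: zero_le_mult_iff)
qed

section \<open>The transfer operator of a contraction\<close>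

lemma cx_operator_transfer:
  "cx_operator (transfer_operator \<alpha> T) M = (\<lambda>\<phi>. if \<phi> \<in> holder_space \<alpha> then M (\<phi> \<circ> T) else 0)"
  by (auto simp: cx_operator_def transfer_operator_def complex_eq_iff)

text \<open>The properties of the map behind all estimates. The final theorem obtains them from the
  mean value inequality and the Banach fixed point theorem.\<close>

locale holder_contraction =
  fixes T :: "real \<Rightarrow> real" and lam a \<alpha> :: real
  assumes maps: "T ` unit_I \<subseteq> unit_I"
    and lam_nonneg: "0 \<le> lam" and lam_less_1: "lam < 1"
    and lipschitz: "\<And>x y. x \<in> unit_I \<Longrightarrow> y \<in> unit_I \<Longrightarrow> \<bar>T x - T y\<bar> \<le> lam * \<bar>x - y\<bar>"
    and fixpoint_in: "a \<in> unit_I" and fixpoint: "T a = a"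
    and \<alpha>_pos: "0 < \<alpha>"
begin

section \<open>Exponential contraction of test functions and, by duality, of functionals\<close>

definition rate :: real where
  "rate = lam powr \<alpha>"

lemma rate_nonneg: "0 \<le> rate"
  by (simp add: rate_def)

lemma rate_less_1: "rate < 1"
  using lam_nonneg lam_less_1 \<alpha>_pos powr_less_mono2[of \<alpha> lam 1] by (simp add: rate_def)

lemma funpow_maps: "x \<in> unit_I \<Longrightarrow> (T ^^ n) x \<in> unit_I"
  using maps by (induction n) (auto simp: image_subset_iff)

lemma funpow_fixpoint: "(T ^^ n) a = a"
  by (induction n) (simp_all add: fixpoint)

lemma funpow_powr_le:
  assumes "x \<in> unit_I" "y \<in> unit_I"
  shows "\<bar>(T ^^ n) x - (T ^^ n) y\<bar> powr \<alpha> \<le> rate ^ n * \<bar>x - y\<bar> powr \<alpha>"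
proof (induction n)
  case (Suc n)
  let ?d = "\<bar>(T ^^ n) x - (T ^^ n) y\<bar>"
  have "\<bar>(T ^^ Suc n) x - (T ^^ Suc n) y\<bar> powr \<alpha> \<le> (lam * ?d) powr \<alpha>"
    using assms \<alpha>_pos lipschitz funpow_maps by (intro powr_mono2) auto
  also have "\<dots> = rate * ?d powr \<alpha>"
    using lam_nonneg by (simp add: powr_mult rate_def)
  also have "\<dots> \<le> rate * (rate ^ n * \<bar>x - y\<bar> powr \<alpha>)"
    using Suc rate_nonneg by (intro mult_left_mono)
  finally show ?case
    by (simp add: mult.assoc)
qed simp

text \<open>Each composition with \<open>T\<close> shrinks the Hoelder seminorm by the factor
  \<open>rate\<close>. The seminorm is replaced by the full norm so that one constant appears in all
  later bounds.\<close>

lemma holder_comp_diff_le: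
  assumes "\<phi> \<in> holder_space \<alpha>" "x \<in> unit_I" "y \<in> unit_I"
  shows "\<bar>\<phi> ((T ^^ n) x) - \<phi> ((T ^^ n) y)\<bar> \<le> holder_norm \<alpha> \<phi> * rate ^ n * \<bar>x - y\<bar> powr \<alpha>"
proof -
  have "\<bar>\<phi> ((T ^^ n) x) - \<phi> ((T ^^ n) y)\<bar> \<le>
      Sup (holder_quotients \<alpha> \<phi>) * \<bar>(T ^^ n) x - (T ^^ n) y\<bar> powr \<alpha>"
    using assms by (intro holder_space_diff_le funpow_maps)
  also have "\<dots> \<le> holder_norm \<alpha> \<phi> * (rate ^ n * \<bar>x - y\<bar> powr \<alpha>)"
    using assms \<alpha>_pos
    by (intro mult_mono Sup_le_holder_norm funpow_powr_le holder_norm_nonneg) auto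
  finally show ?thesis
    by (simp add: mult.assoc)
qed

lemma holder_space_comp_funpow:
  assumes "\<phi> \<in> holder_space \<alpha>"
  shows "\<phi> \<circ> T ^^ n \<in> holder_space \<alpha>"
  using holder_comp_diff_le[OF assms, of _ _ n] unfolding comp_def by (rule holder_spaceI)

lemma holder_space_comp:
  assumes "\<phi> \<in> holder_space \<alpha>"
  shows "\<phi> \<circ> T \<in> holder_space \<alpha>"
  using holder_space_comp_funpow[OF assms, of 1] by simp

text \<open>The function vanishes at \<open>a\<close>, and distances to \<open>a\<close> are at most
  1, so its supremum obeys the same bound as its seminorm; hence the factor 2. Writing the constant
  as \<open>(- \<phi> a) * 1\<close> fits the additivity and scaling rules for functionals.\<close>

lemma holder_norm_comp_funpow_minus_le:
  assumes "\<phi> \<in> holder_space \<alpha>"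
  shows "holder_norm \<alpha> (\<lambda>x. (\<phi> \<circ> T ^^ n) x + (- \<phi> a) * 1) \<le> 2 * holder_norm \<alpha> \<phi> * rate ^ n"
proof -
  let ?h = "holder_norm \<alpha> \<phi> * rate ^ n"
  have "holder_norm \<alpha> (\<lambda>x. (\<phi> \<circ> T ^^ n) x + (- \<phi> a) * 1) \<le> ?h + ?h"
  proof (rule holder_norm_le)
    fix x :: real assume x: "x \<in> unit_I"
    have "\<bar>\<phi> ((T ^^ n) x) - \<phi> ((T ^^ n) a)\<bar> \<le> ?h * \<bar>x - a\<bar> powr \<alpha>"
      using assms x fixpoint_in by (rule holder_comp_diff_le)
    also have "\<dots> \<le> ?h * 1"
      using assms x fixpoint_in \<alpha>_pos rate_nonneg
      by (intro mult_left_mono powr_le_one_on_unit mult_nonneg_nonneg holder_norm_nonneg) auto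
    finally show "\<bar>(\<phi> \<circ> T ^^ n) x + (- \<phi> a) * 1\<bar> \<le> ?h"
      by (simp add: funpow_fixpoint)
  qed (use holder_comp_diff_le[OF assms] in simp)
  then show ?thesis
    by simp
qed

text \<open>The value at \<open>\<phi>\<close> of \<open>L\<^sup>n F - F(1) \<delta>\<^sub>a\<close>.\<close>

definition remainder ::
    "((real \<Rightarrow> real) \<Rightarrow> 'b::real_normed_vector) \<Rightarrow> nat \<Rightarrow> (real \<Rightarrow> real) \<Rightarrow> 'b" where
  "remainder F n \<phi> = F (\<phi> \<circ> T ^^ n) - \<phi> a *\<^sub>R F (\<lambda>_. 1)"

text \<open>Since \<open>a\<close> is fixed, applying the transfer operator to a remainder merely
  advances its index. This drives the telescoping below.\<close>

lemma remainder_comp: "remainder F n (\<phi> \<circ> T) = remainder F (Suc n) \<phi>"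
  by (simp add: remainder_def comp_assoc fixpoint del: comp_apply) (simp add: comp_def fixpoint funpow_swap1)

lemma remainder_add:
  assumes "holder_functional \<alpha> F" "\<phi> \<in> holder_space \<alpha>" "\<psi> \<in> holder_space \<alpha>"
  shows "remainder F n (\<lambda>x. \<phi> x + \<psi> x) = remainder F n \<phi> + remainder F n \<psi>"
proof -
  have "(\<lambda>x. \<phi> x + \<psi> x) \<circ> T ^^ n = (\<lambda>x. (\<phi> \<circ> T ^^ n) x + (\<psi> \<circ> T ^^ n) x)"
    by (simp add: comp_def)
  then show ?thesis
    using assms
    by (simp add: remainder_def holder_functional_add holder_space_comp_funpow scaleR_add_left
        del: comp_apply)
qed

lemma remainder_scale:
  assumes "holder_functional \<alpha> F" "\<phi> \<in> holder_space \<alpha>"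
  shows "remainder F n (\<lambda>x. c * \<phi> x) = c *\<^sub>R remainder F n \<phi>"
proof -
  have "(\<lambda>x. c * \<phi> x) \<circ> T ^^ n = (\<lambda>x. c * (\<phi> \<circ> T ^^ n) x)"
    by (simp add: comp_def)
  then show ?thesis
    using assms
    by (simp add: remainder_def holder_functional_scale holder_space_comp_funpow
        scaleR_right_diff_distrib del: comp_apply)
qed

text \<open>By linearity the remainder is \<open>F\<close> evaluated at the small function of
  \<open>holder_norm_comp_funpow_minus_le\<close>. The constant \<open>K\<close> stays explicit so
  that a norm of \<open>F\<close> can be inserted for it.\<close>

lemma norm_remainder_le:
  assumes "holder_functional \<alpha> F" "0 \<le> K" "\<phi> \<in> holder_space \<alpha>"
    and "\<And>\<phi>. \<phi> \<in> holder_space \<alpha> \<Longrightarrow> norm (F \<phi>) \<le> K * holder_norm \<alpha> \<phi>"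
  shows "norm (remainder F n \<phi>) \<le> 2 * K * holder_norm \<alpha> \<phi> * rate ^ n"
proof -
  let ?\<psi> = "\<lambda>x. (\<phi> \<circ> T ^^ n) x + (- \<phi> a) * 1"
  have c: "(\<lambda>_. (- \<phi> a) * 1) \<in> holder_space \<alpha>"
    by (rule holder_space_const)
  have "F ?\<psi> = F (\<phi> \<circ> T ^^ n) + F (\<lambda>_. (- \<phi> a) * 1)"
    using holder_functional_add[OF assms(1) holder_space_comp_funpow[OF assms(3)] c] .
  also have "F (\<lambda>_. (- \<phi> a) * 1) = (- \<phi> a) *\<^sub>R F (\<lambda>_. 1)"
    using assms(1) holder_space_const by (rule holder_functional_scale)
  finally have "remainder F n \<phi> = F ?\<psi>"
    by (simp only: remainder_def scaleR_minus_left add_uminus_conv_diff)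
  moreover have "norm (F ?\<psi>) \<le> K * holder_norm \<alpha> ?\<psi>"
    using holder_space_add[OF holder_space_comp_funpow[OF assms(3)] c] by (rule assms(4))
  moreover have "\<dots> \<le> K * (2 * holder_norm \<alpha> \<phi> * rate ^ n)"
    using assms(2) holder_norm_comp_funpow_minus_le[OF assms(3)] by (intro mult_left_mono)
  ultimately show ?thesis
    by (simp add: ac_simps)
qed

lemma rate_quotient_powers:
  fixes z :: complex
  assumes "rate < cmod z"
  shows "summable (\<lambda>n. rate ^ n / cmod z ^ Suc n)"
    and "(\<lambda>n. rate ^ n / cmod z ^ n) \<longlonglongrightarrow> 0"
proof -
  have "0 < cmod z"
    using assms rate_nonneg by linarith
  then have q: "norm (rate / cmod z) < 1"
    using assms rate_nonneg by (simp only: real_norm_def abs_divide abs_norm_cancel) simp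
  then have "summable (\<lambda>n. inverse (cmod z) * (rate / cmod z) ^ n)"
    by (intro summable_mult summable_geometric)
  then show "summable (\<lambda>n. rate ^ n / cmod z ^ Suc n)"
    by (simp add: power_divide field_simps)
  show "(\<lambda>n. rate ^ n / cmod z ^ n) \<longlonglongrightarrow> 0"
    using LIMSEQ_power_zero[OF q] by (simp add: power_divide)
qed

text \<open>This disposes of the end term of the telescoping sum.\<close>

lemma remainder_tendsto_0:
  fixes z :: complex
  assumes "rate < cmod z" "holder_functional \<alpha> M" "\<phi> \<in> holder_space \<alpha>"
  shows "(\<lambda>n. remainder M n \<phi> / z ^ n) \<longlonglongrightarrow> 0"
proof -
  obtain K where K: "0 \<le> K" "\<And>\<phi>. \<phi> \<in> holder_space \<alpha> \<Longrightarrow> norm (M \<phi>) \<le> K * holder_norm \<alpha> \<phi>"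
    using holder_functional_bound[OF \<alpha>_pos assms(2)] by blast
  have "cmod (remainder M n \<phi> / z ^ n) \<le> 2 * K * holder_norm \<alpha> \<phi> * (rate ^ n / cmod z ^ n)" for n
    using divide_right_mono[OF norm_remainder_le[OF assms(2) K(1) assms(3) K(2)], of "cmod z ^ n" n]
    by (simp add: norm_divide norm_power)
  moreover have "(\<lambda>n. 2 * K * holder_norm \<alpha> \<phi> * (rate ^ n / cmod z ^ n)) \<longlonglongrightarrow> 0"
    using tendsto_mult_right_zero[OF rate_quotient_powers(2)[OF assms(1)]] .
  ultimately show ?thesis
    by (intro Lim_null_comparison[of "\<lambda>n. remainder M n \<phi> / z ^ n"]) simp_all
qed

text \<open>For an invariant functional the remainders do not depend on the index, yet they tend to
  0, so they vanish. The general codomain covers real distributions as well as elements of the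
  complexification.\<close>

lemma holder_functional_invariant:
  fixes F :: "(real \<Rightarrow> real) \<Rightarrow> 'b::real_normed_vector"
  assumes "holder_functional \<alpha> F" "\<phi> \<in> holder_space \<alpha>"
    and inv: "\<And>\<phi>. \<phi> \<in> holder_space \<alpha> \<Longrightarrow> F (\<phi> \<circ> T) = F \<phi>"
  shows "F \<phi> = \<phi> a *\<^sub>R F (\<lambda>_. 1)"
proof -
  obtain K where K: "0 \<le> K" "\<And>\<phi>. \<phi> \<in> holder_space \<alpha> \<Longrightarrow> norm (F \<phi>) \<le> K * holder_norm \<alpha> \<phi>"
    using holder_functional_bound[OF \<alpha>_pos assms(1)] by blast
  have "F (\<phi> \<circ> T ^^ n) = F \<phi>" for n
  proof (induction n)
    case (Suc n)
    then show ?case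
      using inv[OF holder_space_comp_funpow[OF assms(2), of n]]
      by (simp only: funpow_Suc_right comp_assoc)
  qed simp
  then have "remainder F n \<phi> = F \<phi> - \<phi> a *\<^sub>R F (\<lambda>_. 1)" for n
    by (simp add: remainder_def)
  then have "norm (F \<phi> - \<phi> a *\<^sub>R F (\<lambda>_. 1)) \<le> 2 * K * holder_norm \<alpha> \<phi> * rate ^ n" for n
    using norm_remainder_le[OF assms(1) K(1) assms(2) K(2)] by metis
  moreover have "(\<lambda>n. 2 * K * holder_norm \<alpha> \<phi> * rate ^ n) \<longlonglongrightarrow> 0"
    using rate_nonneg rate_less_1 by (intro tendsto_mult_right_zero LIMSEQ_power_zero) simp
  ultimately have "norm (F \<phi> - \<phi> a *\<^sub>R F (\<lambda>_. 1)) \<le> 0"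
    by (intro LIMSEQ_le_const) auto
  then show ?thesis
    by simp
qed

section \<open>The Neumann series, formed pointwise at each test function\<close>

definition neumann :: "complex \<Rightarrow> ((real \<Rightarrow> real) \<Rightarrow> complex) \<Rightarrow> (real \<Rightarrow> real) \<Rightarrow> complex" where
  "neumann z M \<phi> = (if \<phi> \<in> holder_space \<alpha> then \<Sum>n. remainder M n \<phi> / z ^ Suc n else 0)"

text \<open>A geometric series of ratio \<open>rate / cmod z\<close> dominates. The second bound is
  linear in \<open>K\<close>, which later yields a bounded resolvent.\<close>

lemma neumann_summable:
  assumes "rate < cmod z" "holder_functional \<alpha> M" "\<phi> \<in> holder_space \<alpha>"
    and "0 \<le> K" "\<And>\<phi>. \<phi> \<in> holder_space \<alpha> \<Longrightarrow> norm (M \<phi>) \<le> K * holder_norm \<alpha> \<phi>"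
  shows "summable (\<lambda>n. remainder M n \<phi> / z ^ Suc n)"
    and "cmod (neumann z M \<phi>) \<le> 2 * (\<Sum>n. rate ^ n / cmod z ^ Suc n) * K * holder_norm \<alpha> \<phi>"
proof -
  let ?c = "2 * K * holder_norm \<alpha> \<phi>"
  have le: "cmod (remainder M n \<phi> / z ^ Suc n) \<le> ?c * (rate ^ n / cmod z ^ Suc n)" for n
    using divide_right_mono[OF norm_remainder_le[OF assms(2,4,3,5)], of "cmod z ^ Suc n" n]
    by (simp add: norm_divide norm_power norm_mult)
  have sm: "summable (\<lambda>n. ?c * (rate ^ n / cmod z ^ Suc n))"
    using rate_quotient_powers(1)[OF assms(1)] by (rule summable_mult)
  show "summable (\<lambda>n. remainder M n \<phi> / z ^ Suc n)"
    using sm le by (intro summable_comparison_test[OF _ sm]) blast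
  have "cmod (neumann z M \<phi>) \<le> (\<Sum>n. ?c * (rate ^ n / cmod z ^ Suc n))"
    using assms(3) norm_suminf_le[OF le sm] by (simp add: neumann_def)
  also have "\<dots> = ?c * (\<Sum>n. rate ^ n / cmod z ^ Suc n)"
    using rate_quotient_powers(1)[OF assms(1)] by (rule suminf_mult)
  finally show "cmod (neumann z M \<phi>) \<le> 2 * (\<Sum>n. rate ^ n / cmod z ^ Suc n) * K * holder_norm \<alpha> \<phi>"
    by (simp only: ac_simps)
qed

lemma neumann_sums:
  assumes "rate < cmod z" "holder_functional \<alpha> M" "\<phi> \<in> holder_space \<alpha>"
  shows "(\<lambda>n. remainder M n \<phi> / z ^ Suc n) sums neumann z M \<phi>"
proof -
  obtain K where K: "0 \<le> K" "\<And>\<phi>. \<phi> \<in> holder_space \<alpha> \<Longrightarrow> norm (M \<phi>) \<le> K * holder_norm \<alpha> \<phi>"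
    using holder_functional_bound[OF \<alpha>_pos assms(2)] by blast
  then show ?thesis
    using neumann_summable(1)[OF assms K] assms(3) summable_sums by (simp add: neumann_def)
qed

lemma holder_functional_neumann:
  assumes "rate < cmod z" "holder_functional \<alpha> M"
  shows "holder_functional \<alpha> (neumann z M)"
proof -
  obtain K where K: "0 \<le> K" "\<And>\<phi>. \<phi> \<in> holder_space \<alpha> \<Longrightarrow> norm (M \<phi>) \<le> K * holder_norm \<alpha> \<phi>"
    using holder_functional_bound[OF \<alpha>_pos assms(2)] by blast
  show ?thesis
  proof (rule holder_functionalI)
    fix \<phi> \<psi> assume \<phi>\<psi>: "\<phi> \<in> holder_space \<alpha>" "\<psi> \<in> holder_space \<alpha>"
    have "(\<lambda>n. remainder M n (\<lambda>x. \<phi> x + \<psi> x) / z ^ Suc n) sums (neumann z M \<phi> + neumann z M \<psi>)"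
      using sums_add[OF neumann_sums[OF assms \<phi>\<psi>(1)] neumann_sums[OF assms \<phi>\<psi>(2)]]
      by (simp add: remainder_add[OF assms(2) \<phi>\<psi>] add_divide_distrib)
    then show "neumann z M (\<lambda>x. \<phi> x + \<psi> x) = neumann z M \<phi> + neumann z M \<psi>"
      using neumann_sums[OF assms holder_space_add[OF \<phi>\<psi>]] sums_unique2 by blast
  next
    fix c \<phi> assume \<phi>: "\<phi> \<in> holder_space \<alpha>"
    have "(\<lambda>n. remainder M n (\<lambda>x. c * \<phi> x) / z ^ Suc n) sums (c *\<^sub>R neumann z M \<phi>)"
      using sums_scaleR_right[OF neumann_sums[OF assms \<phi>], of c]
      by (simp add: remainder_scale[OF assms(2) \<phi>] scaleR_conv_of_real)
    then show "neumann z M (\<lambda>x. c * \<phi> x) = c *\<^sub>R neumann z M \<phi>"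
      using neumann_sums[OF assms holder_space_scale[OF \<phi>]] sums_unique2 by blast
  next
    fix \<phi> assume "\<phi> \<in> holder_space \<alpha>"
    then show "cmod (neumann z M \<phi>) \<le> (2 * (\<Sum>n. rate ^ n / cmod z ^ Suc n) * K) * holder_norm \<alpha> \<phi>"
      using neumann_summable(2)[OF assms _ K] by blast
  qed (simp add: neumann_def)
qed

text \<open>Each term is the difference of consecutive members of the sequence
  \<open>remainder M n \<phi> / z ^ n\<close>. The limit is 0, so the sum is minus the initial
  member, which is \<open>M \<phi> - \<phi> a *\<^sub>R M (\<lambda>_. 1)\<close>.\<close>

lemma telescoping_remainder_sums:
  assumes "rate < cmod z" "holder_functional \<alpha> M" "\<phi> \<in> holder_space \<alpha>"
  shows "(\<lambda>n. (remainder M (Suc n) \<phi> - z * remainder M n \<phi>) / z ^ Suc n) sums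
    (\<phi> a *\<^sub>R M (\<lambda>_. 1) - M \<phi>)"
proof -
  have "z \<noteq> 0"
    using assms(1) rate_nonneg by auto
  then have "(remainder M (Suc n) \<phi> - z * remainder M n \<phi>) / z ^ Suc n =
      remainder M (Suc n) \<phi> / z ^ Suc n - remainder M n \<phi> / z ^ n" for n
    by (simp add: diff_divide_distrib)
  then show ?thesis
    using telescope_sums[OF remainder_tendsto_0[OF assms]] by (simp add: remainder_def)
qed

section \<open>The shifted operator and its composition with the Neumann series\<close>

abbreviation shift :: "complex \<Rightarrow> ((real \<Rightarrow> real) \<Rightarrow> complex) \<Rightarrow> (real \<Rightarrow> real) \<Rightarrow> complex" where
  "shift \<equiv> cx_shift (transfer_operator \<alpha> T)"

lemma shift_eq:
  assumes "holder_functional \<alpha> M"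
  shows "shift z M \<phi> = (if \<phi> \<in> holder_space \<alpha> then M (\<phi> \<circ> T) - z * M \<phi> else 0)"
  using holder_functional_outside[OF assms] by (simp add: cx_shift_def cx_operator_transfer)

text \<open>The transfer operator preserves total mass, because constants are unchanged by
  composition with \<open>T\<close>.\<close>

lemma shift_one:
  assumes "holder_functional \<alpha> M"
  shows "shift z M (\<lambda>_. 1) = (1 - z) * M (\<lambda>_. 1)"
  using holder_space_const[of 1 \<alpha>] by (simp add: shift_eq[OF assms] comp_def left_diff_distrib)

lemma holder_functional_shift:
  assumes "holder_functional \<alpha> M"
  shows "holder_functional \<alpha> (shift z M)"
proof -
  obtain K where K: "0 \<le> K" "\<And>\<phi>. \<phi> \<in> holder_space \<alpha> \<Longrightarrow> norm (M \<phi>) \<le> K * holder_norm \<alpha> \<phi>"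
    using holder_functional_bound[OF \<alpha>_pos assms] by blast
  have "holder_functional \<alpha> (\<lambda>\<phi>. if \<phi> \<in> holder_space \<alpha> then M (\<phi> \<circ> T) else 0)"
  proof (rule holder_functionalI)
    fix \<phi> \<psi> assume \<phi>\<psi>: "\<phi> \<in> holder_space \<alpha>" "\<psi> \<in> holder_space \<alpha>"
    have "(\<lambda>x. \<phi> x + \<psi> x) \<circ> T = (\<lambda>x. (\<phi> \<circ> T) x + (\<psi> \<circ> T) x)"
      by (simp add: comp_def)
    then show "(if (\<lambda>x. \<phi> x + \<psi> x) \<in> holder_space \<alpha> then M ((\<lambda>x. \<phi> x + \<psi> x) \<circ> T) else 0) =
        (if \<phi> \<in> holder_space \<alpha> then M (\<phi> \<circ> T) else 0) + (if \<psi> \<in> holder_space \<alpha> then M (\<psi> \<circ> T) else 0)"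
      using \<phi>\<psi> by (simp add: holder_space_add holder_functional_add[OF assms] holder_space_comp
          del: comp_apply)
  next
    fix c \<phi> assume \<phi>: "\<phi> \<in> holder_space \<alpha>"
    have "(\<lambda>x. c * \<phi> x) \<circ> T = (\<lambda>x. c * (\<phi> \<circ> T) x)"
      by (simp add: comp_def)
    then show "(if (\<lambda>x. c * \<phi> x) \<in> holder_space \<alpha> then M ((\<lambda>x. c * \<phi> x) \<circ> T) else 0) =
        c *\<^sub>R (if \<phi> \<in> holder_space \<alpha> then M (\<phi> \<circ> T) else 0)"
      using \<phi> by (simp add: holder_space_scale holder_functional_scale[OF assms] holder_space_comp
          del: comp_apply)
  next
    fix \<phi> assume \<phi>: "\<phi> \<in> holder_space \<alpha>"
    \<comment> \<open>The first summand bounds the supremum, the second the seminorm; a crude bound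
      is enough for continuity of the operator.\<close>
    have "holder_norm \<alpha> (\<phi> \<circ> T) \<le> holder_norm \<alpha> \<phi> + holder_norm \<alpha> \<phi> * rate ^ 1"
      using abs_le_holder_norm[OF \<alpha>_pos \<phi>] funpow_maps[of _ 1] holder_comp_diff_le[OF \<phi>, of _ _ 1]
      by (intro holder_norm_le) auto
    then have "K * holder_norm \<alpha> (\<phi> \<circ> T) \<le> K * (1 + rate) * holder_norm \<alpha> \<phi>"
      using mult_left_mono[OF _ K(1)] by (fastforce simp: algebra_simps)
    then show "cmod (if \<phi> \<in> holder_space \<alpha> then M (\<phi> \<circ> T) else 0) \<le>
        K * (1 + rate) * holder_norm \<alpha> \<phi>"
      using \<phi> K(2)[OF holder_space_comp[OF \<phi>]] by simp
  qed simp
  then show ?thesis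
    unfolding cx_shift_def cx_operator_transfer
    using \<alpha>_pos assms by (intro holder_functional_diff holder_functional_cmult)
qed

lemma shift_neumann:
  assumes "rate < cmod z" "holder_functional \<alpha> M" "\<phi> \<in> holder_space \<alpha>"
  shows "shift z (neumann z M) \<phi> = \<phi> a *\<^sub>R M (\<lambda>_. 1) - M \<phi>"
proof -
  have "(\<lambda>n. remainder M (Suc n) \<phi> / z ^ Suc n - z * (remainder M n \<phi> / z ^ Suc n)) sums
      (neumann z M (\<phi> \<circ> T) - z * neumann z M \<phi>)"
    using neumann_sums[OF assms(1,2) holder_space_comp[OF assms(3)]] neumann_sums[OF assms]
    unfolding remainder_comp by (intro sums_diff sums_mult)
  then have "(\<lambda>n. (remainder M (Suc n) \<phi> - z * remainder M n \<phi>) / z ^ Suc n) sums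
      (neumann z M (\<phi> \<circ> T) - z * neumann z M \<phi>)"
    by (simp add: diff_divide_distrib)
  then show ?thesis
    using telescoping_remainder_sums[OF assms] assms(3) sums_unique2
    by (simp add: shift_eq[OF holder_functional_neumann[OF assms(1,2)]])
qed

lemma neumann_shift:
  assumes "rate < cmod z" "holder_functional \<alpha> M" "\<phi> \<in> holder_space \<alpha>"
  shows "neumann z (shift z M) \<phi> = \<phi> a *\<^sub>R M (\<lambda>_. 1) - M \<phi>"
proof -
  \<comment> \<open>The constant parts agree by \<open>shift_one\<close>: both sides carry the
    multiple \<open>1 - z\<close> of the mass of \<open>M\<close>. The series is then the same
    telescoping one as in \<open>shift_neumann\<close>.\<close>
  have "remainder (shift z M) n \<phi> = remainder M (Suc n) \<phi> - z * remainder M n \<phi>" for n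
  proof -
    have "\<phi> \<circ> T ^^ n \<circ> T = \<phi> \<circ> T ^^ Suc n"
      by (simp only: funpow_Suc_right comp_assoc)
    then show ?thesis
      using shift_one[OF assms(2)] holder_space_comp_funpow[OF assms(3), of n]
        holder_space_const[of 1 \<alpha>]
      by (simp add: remainder_def shift_eq[OF assms(2)] algebra_simps scaleR_conv_of_real
          del: funpow.simps comp_apply)
  qed
  then have "(\<lambda>n. (remainder M (Suc n) \<phi> - z * remainder M n \<phi>) / z ^ Suc n) sums
      neumann z (shift z M) \<phi>"
    using neumann_sums[OF assms(1) holder_functional_shift[OF assms(2), of z] assms(3)]
    by (simp only:)
  then show ?thesis
    using telescoping_remainder_sums[OF assms] by (rule sums_unique2)
qed

section \<open>The point mass as a complex eigenvector, the resolvent and the spectrum\<close>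

definition delta :: "(real \<Rightarrow> real) \<Rightarrow> complex" where
  "delta \<phi> = of_real (point_mass \<alpha> a \<phi>)"

lemma delta_eq: "delta \<phi> = (if \<phi> \<in> holder_space \<alpha> then of_real (\<phi> a) else 0)"
  by (simp add: delta_def point_mass_eq[OF \<alpha>_pos fixpoint_in])

lemma delta_one: "delta (\<lambda>_. 1) = 1"
  using holder_space_const[of 1 \<alpha>] by (simp add: delta_eq)

lemma holder_functional_point_mass: "holder_functional \<alpha> (point_mass \<alpha> a)"
  by (rule holder_functionalI[where K = 1])
    (auto simp: point_mass_eq[OF \<alpha>_pos fixpoint_in] holder_space_add holder_space_scale
      abs_le_holder_norm[OF \<alpha>_pos _ fixpoint_in])

lemma holder_functional_delta: "holder_functional \<alpha> delta"
  by (rule holder_functionalI[where K = 1])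
    (auto simp: delta_eq holder_space_add holder_space_scale scaleR_conv_of_real
      abs_le_holder_norm[OF \<alpha>_pos _ fixpoint_in])

lemma shift_delta: "shift z delta = (\<lambda>\<phi>. (1 - z) * delta \<phi>)"
  by (rule ext) (simp add: shift_eq[OF holder_functional_delta] delta_eq holder_space_comp fixpoint
      left_diff_distrib)

text \<open>The first summand inverts the shifted operator on the line of \<open>delta\<close>,
  where it acts as \<open>1 - z\<close>; the second inverts it on functionals of mass 0.\<close>

definition resolvent :: "complex \<Rightarrow> ((real \<Rightarrow> real) \<Rightarrow> complex) \<Rightarrow> (real \<Rightarrow> real) \<Rightarrow> complex" where
  "resolvent z M \<phi> = M (\<lambda>_. 1) / (1 - z) * delta \<phi> - neumann z M \<phi>"

lemma holder_functional_resolvent: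
  assumes "rate < cmod z" "holder_functional \<alpha> M"
  shows "holder_functional \<alpha> (resolvent z M)"
  unfolding resolvent_def
  using assms \<alpha>_pos holder_functional_delta
  by (intro holder_functional_diff holder_functional_cmult holder_functional_neumann)

text \<open>The first summand contributes the mass of \<open>M\<close> times \<open>delta\<close>,
  which cancels the point mass term in \<open>shift_neumann\<close>. The same cancellation, with
  \<open>neumann_shift\<close>, gives the inverse from the other side.\<close>

lemma shift_resolvent:
  assumes "rate < cmod z" "z \<noteq> 1" "holder_functional \<alpha> M"
  shows "shift z (resolvent z M) = M"
proof
  fix \<phi>
  show "shift z (resolvent z M) \<phi> = M \<phi>"
  proof (cases "\<phi> \<in> holder_space \<alpha>")
    case True
    have "shift z (resolvent z M) \<phi> =
        M (\<lambda>_. 1) / (1 - z) * shift z delta \<phi> - shift z (neumann z M) \<phi>"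
      using True holder_functional_delta assms
      by (simp add: shift_eq holder_functional_neumann holder_functional_resolvent)
        (simp add: resolvent_def algebra_simps diff_divide_distrib)
    also have "\<dots> = M \<phi>"
      using assms(2) True
      by (simp add: shift_neumann[OF assms(1,3) True] shift_delta delta_eq scaleR_conv_of_real)
    finally show ?thesis .
  qed (use assms in \<open>simp add: shift_eq holder_functional_resolvent holder_functional_outside\<close>)
qed

lemma resolvent_shift:
  assumes "rate < cmod z" "z \<noteq> 1" "holder_functional \<alpha> M"
  shows "resolvent z (shift z M) = M"
proof
  fix \<phi>
  show "resolvent z (shift z M) \<phi> = M \<phi>"
  proof (cases "\<phi> \<in> holder_space \<alpha>")
    case True
    then show ?thesis
      using assms(2)
      by (simp add: resolvent_def neumann_shift[OF assms(1,3)] shift_one[OF assms(3)] delta_eq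
          scaleR_conv_of_real)
  qed (use assms in \<open>simp add: resolvent_def neumann_def delta_eq holder_functional_outside\<close>)
qed

text \<open>By \<open>cmod_le_cx_norm\<close> the norm of \<open>M\<close> may serve as
  \<open>K\<close> in \<open>neumann_summable\<close>, so the constant does not depend on
  \<open>M\<close>: \<open>?c\<close> accounts for the point mass and \<open>2 * ?S\<close> for the
  series. At \<open>z = 1\<close> the quotients are 0 by convention.\<close>

lemma cx_norm_resolvent_le:
  assumes "rate < cmod z"
  shows "\<exists>K. \<forall>M. holder_functional \<alpha> M \<longrightarrow>
    cx_norm (distribution_norm \<alpha>) (resolvent z M) \<le> K * cx_norm (distribution_norm \<alpha>) M"
proof (intro exI allI impI)
  fix M :: "(real \<Rightarrow> real) \<Rightarrow> complex" assume M: "holder_functional \<alpha> M"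
  let ?N = "cx_norm (distribution_norm \<alpha>) M" and ?S = "\<Sum>n. rate ^ n / cmod z ^ Suc n"
  let ?c = "holder_norm \<alpha> (\<lambda>_. 1) / cmod (1 - z)"
  have S: "0 \<le> ?S"
    using rate_nonneg by (intro suminf_nonneg rate_quotient_powers assms) simp
  have c: "0 \<le> ?c"
    by (intro divide_nonneg_nonneg holder_norm_nonneg \<alpha>_pos holder_space_const) simp
  have N: "0 \<le> ?N"
    using \<alpha>_pos M by (rule cx_norm_nonneg)
  show "cx_norm (distribution_norm \<alpha>) (resolvent z M) \<le> (?c + 2 * ?S) * ?N"
  proof (rule cx_norm_le[OF \<alpha>_pos])
    fix \<phi> assume \<phi>: "\<phi> \<in> holder_space \<alpha>"
    have "cmod (delta \<phi>) \<le> holder_norm \<alpha> \<phi>"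
      using \<phi> abs_le_holder_norm[OF \<alpha>_pos \<phi> fixpoint_in] by (simp add: delta_eq)
    moreover have "cmod (M (\<lambda>_. 1)) / cmod (1 - z) \<le> ?N * holder_norm \<alpha> (\<lambda>_. 1) / cmod (1 - z)"
      using cmod_le_cx_norm[OF \<alpha>_pos M holder_space_const[of 1]] by (intro divide_right_mono) auto
    ultimately have "cmod (M (\<lambda>_. 1) / (1 - z) * delta \<phi>) \<le> ?c * ?N * holder_norm \<alpha> \<phi>"
      using mult_mono[of "cmod (M (\<lambda>_. 1)) / cmod (1 - z)" "?c * ?N" "cmod (delta \<phi>)"
          "holder_norm \<alpha> \<phi>"] mult_nonneg_nonneg[OF c N]
      by (simp add: norm_mult norm_divide mult.commute)
    moreover have "cmod (neumann z M \<phi>) \<le> 2 * ?S * ?N * holder_norm \<alpha> \<phi>"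
      using assms M \<phi> N cmod_le_cx_norm[OF \<alpha>_pos M] by (rule neumann_summable(2))
    ultimately show "cmod (resolvent z M \<phi>) \<le> (?c + 2 * ?S) * ?N * holder_norm \<alpha> \<phi>"
      unfolding resolvent_def distrib_right
      using norm_triangle_ineq4[of "M (\<lambda>_. 1) / (1 - z) * delta \<phi>" "neumann z M \<phi>"] by linarith
  qed (use S c N in simp)
qed

lemma spectrum_subset:
  "spectrum (distributions \<alpha>) (distribution_norm \<alpha>) (transfer_operator \<alpha> T) - {1} \<subseteq>
    {z. cmod z \<le> rate}"
proof (intro subsetI CollectI)
  fix z assume z: "z \<in> spectrum (distributions \<alpha>) (distribution_norm \<alpha>) (transfer_operator \<alpha> T) - {1}"
  show "cmod z \<le> rate"
  proof (rule ccontr)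
    assume "\<not> cmod z \<le> rate"
    then have "rate < cmod z" "z \<noteq> 1"
      using z by auto
    then have "z \<notin> spectrum (distributions \<alpha>) (distribution_norm \<alpha>) (transfer_operator \<alpha> T)"
      unfolding spectrum_def mem_Collect_eq not_not Ball_def cx_space_distributions_iff[OF \<alpha>_pos]
      using cx_norm_resolvent_le holder_functional_resolvent resolvent_shift shift_resolvent
      by (intro exI[of _ "resolvent z"]) blast
    then show False
      using z by blast
  qed
qed

section \<open>Algebraic simplicity of the eigenvalue 1\<close>

lemma shift_1_kernel:
  assumes "holder_functional \<alpha> M" "shift 1 M = (\<lambda>_. 0)"
  shows "M = (\<lambda>\<phi>. M (\<lambda>_. 1) * delta \<phi>)"
proof
  fix \<phi>
  have "M (\<psi> \<circ> T) = M \<psi>" if "\<psi> \<in> holder_space \<alpha>" for \<psi>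
    using fun_cong[OF assms(2), of \<psi>] that by (simp add: shift_eq[OF assms(1)])
  then show "M \<phi> = M (\<lambda>_. 1) * delta \<phi>"
    using holder_functional_invariant[OF assms(1), of \<phi>] holder_functional_outside[OF assms(1), of \<phi>]
    by (simp add: delta_eq scaleR_conv_of_real mult.commute)
qed

lemma shift_1_generalized_kernel:
  assumes "holder_functional \<alpha> M" "(shift 1 ^^ k) M = (\<lambda>_. 0)"
  shows "M \<in> range (\<lambda>c \<phi>. c * delta \<phi>)"
  using assms
proof (induction k arbitrary: M)
  case 0
  then show ?case
    by (auto intro!: range_eqI[of _ _ 0])
next
  case (Suc k)
  then have "(shift 1 ^^ k) (shift 1 M) = (\<lambda>_. 0)"
    by (simp add: funpow_swap1)
  then obtain c where c: "shift 1 M = (\<lambda>\<phi>. c * delta \<phi>)"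
    using Suc.IH[OF holder_functional_shift[OF Suc.prems(1)]] by blast
  txt \<open>There are no Jordan blocks because every \<open>shift 1 M\<close> vanishes at the constant 1.\<close>
  then have "c = 0"
    using shift_one[OF Suc.prems(1), of 1] by (simp add: delta_one)
  then show ?case
    using shift_1_kernel[OF Suc.prems(1)] c by auto
qed

lemma simple_eigenvalue_1:
  "simple_eigenvalue (distributions \<alpha>) (transfer_operator \<alpha> T) 1"
  unfolding simple_eigenvalue_def
proof (intro bexI[of _ delta] conjI ballI)
  show "delta \<noteq> (\<lambda>_. 0)"
    using delta_one by (metis zero_neq_one)
  show "shift 1 delta = (\<lambda>_. 0)"
    by (simp add: shift_delta)
  show "{M \<in> cx_space (distributions \<alpha>). \<exists>k. (shift 1 ^^ k) M = (\<lambda>_. 0)} = range (\<lambda>c x. c * delta x)"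
  proof (intro equalityI subsetI)
    fix M assume "M \<in> range (\<lambda>c x. c * delta x)"
    then obtain c where c: "M = (\<lambda>x. c * delta x)"
      by blast
    have M: "holder_functional \<alpha> M"
      unfolding c using \<alpha>_pos holder_functional_delta by (rule holder_functional_cmult)
    have "shift 1 M = (\<lambda>_. 0)"
      by (rule ext) (simp add: shift_eq[OF M], simp add: c delta_eq holder_space_comp fixpoint)
    then have "(shift 1 ^^ 1) M = (\<lambda>_. 0)"
      by simp
    then show "M \<in> {M \<in> cx_space (distributions \<alpha>). \<exists>k. (shift 1 ^^ k) M = (\<lambda>_. 0)}"
      using M by (auto simp: cx_space_distributions_iff[OF \<alpha>_pos] simp del: funpow.simps)
  qed (auto simp: cx_space_distributions_iff[OF \<alpha>_pos] intro: shift_1_generalized_kernel)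
  show "delta \<in> cx_space (distributions \<alpha>)"
    by (simp add: cx_space_distributions_iff[OF \<alpha>_pos] holder_functional_delta)
next
  fix M assume "M \<in> cx_space (distributions \<alpha>)"
  then have M: "holder_functional \<alpha> M"
    by (simp add: cx_space_distributions_iff[OF \<alpha>_pos])
  \<comment> \<open>The sign turns \<open>shift_neumann\<close> at 1 into a decomposition of
    \<open>M\<close> into a multiple of \<open>delta\<close> and an element of the range.\<close>
  define M' where "M' = (\<lambda>\<phi>. (- 1) * neumann 1 M \<phi>)"
  have rate1: "rate < cmod 1"
    using rate_less_1 by simp
  have M': "holder_functional \<alpha> M'"
    unfolding M'_def using \<alpha>_pos M rate1
    by (intro holder_functional_cmult holder_functional_neumann)
  have "M \<phi> = M (\<lambda>_. 1) * delta \<phi> + shift 1 M' \<phi>" for \<phi>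
  proof (cases "\<phi> \<in> holder_space \<alpha>")
    case True
    have "shift 1 M' \<phi> = - shift 1 (neumann 1 M) \<phi>"
      using True by (simp add: shift_eq[OF M'] shift_eq[OF holder_functional_neumann[OF rate1 M]])
        (simp add: M'_def)
    then show ?thesis
      using True by (simp add: shift_neumann[OF rate1 M True] delta_eq scaleR_conv_of_real)
  qed (simp add: shift_eq[OF M'] delta_eq holder_functional_outside[OF M])
  then have "M = (\<lambda>\<phi>. M (\<lambda>_. 1) * delta \<phi> + shift 1 M' \<phi>)"
    by (rule ext)
  then show "\<exists>c. \<exists>M'\<in>cx_space (distributions \<alpha>). M = (\<lambda>x. c * delta x + shift 1 M' x)"
    using M' cx_space_distributions_iff[OF \<alpha>_pos] by blast
qed

section \<open>Invariant distributions and exponential convergence\<close>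

lemma invariant_distributions:
  "{\<mu> \<in> distributions \<alpha>. transfer_operator \<alpha> T \<mu> = \<mu>} = range (\<lambda>c \<phi>. c * point_mass \<alpha> a \<phi>)"
proof (intro equalityI subsetI)
  fix \<mu> assume "\<mu> \<in> {\<mu> \<in> distributions \<alpha>. transfer_operator \<alpha> T \<mu> = \<mu>}"
  then have \<mu>: "holder_functional \<alpha> \<mu>" and inv: "transfer_operator \<alpha> T \<mu> = \<mu>"
    by (simp_all add: distributions_iff)
  have "\<mu> (\<psi> \<circ> T) = \<mu> \<psi>" if "\<psi> \<in> holder_space \<alpha>" for \<psi>
    using fun_cong[OF inv, of \<psi>] that by (simp add: transfer_operator_def)
  then have "\<mu> \<phi> = \<mu> (\<lambda>_. 1) * point_mass \<alpha> a \<phi>" for \<phi>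
    using holder_functional_invariant[OF \<mu>, of \<phi>] holder_functional_outside[OF \<mu>, of \<phi>]
    by (simp add: point_mass_eq[OF \<alpha>_pos fixpoint_in])
  then show "\<mu> \<in> range (\<lambda>c \<phi>. c * point_mass \<alpha> a \<phi>)"
    by (intro range_eqI[of _ _ "\<mu> (\<lambda>_. 1)"]) (rule ext)
next
  fix \<mu> assume "\<mu> \<in> range (\<lambda>c \<phi>. c * point_mass \<alpha> a \<phi>)"
  then obtain c where "\<mu> = (\<lambda>\<phi>. c * point_mass \<alpha> a \<phi>)"
    by blast
  then show "\<mu> \<in> {\<mu> \<in> distributions \<alpha>. transfer_operator \<alpha> T \<mu> = \<mu>}"
    using holder_functional_cmult[OF \<alpha>_pos holder_functional_point_mass, of c]
    by (auto simp: distributions_iff transfer_operator_def point_mass_eq[OF \<alpha>_pos fixpoint_in]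
        holder_space_comp fixpoint)
qed

text \<open>The outermost application replaces the test function by its composition with
  \<open>T\<close>, so the induction must range over all test functions.\<close>

lemma transfer_operator_funpow:
  assumes "\<phi> \<in> holder_space \<alpha>"
  shows "(transfer_operator \<alpha> T ^^ n) \<mu> \<phi> = \<mu> (\<phi> \<circ> T ^^ n)"
  using assms
proof (induction n arbitrary: \<phi>)
  case (Suc n)
  have "(transfer_operator \<alpha> T ^^ Suc n) \<mu> \<phi> = (transfer_operator \<alpha> T ^^ n) \<mu> (\<phi> \<circ> T)"
    using Suc.prems by (simp add: transfer_operator_def[of \<alpha> T "(transfer_operator \<alpha> T ^^ n) \<mu>"])
  then show ?case
    using Suc.IH[OF holder_space_comp[OF Suc.prems]] by (simp only: comp_assoc funpow.simps)
qed simp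

text \<open>For mass 1 the difference from the point mass is exactly the remainder. The rate is
  common to all distributions; \<open>C\<close> depends on a bound for the given one.\<close>

lemma exponential_convergence:
  "\<exists>\<rho>. 0 < \<rho> \<and> \<rho> < 1 \<and> (\<forall>\<mu>\<in>distributions \<alpha>. \<mu> (\<lambda>_. 1) = 1 \<longrightarrow>
    (\<exists>C. \<forall>n. distribution_norm \<alpha>
      (\<lambda>\<phi>. (transfer_operator \<alpha> T ^^ n) \<mu> \<phi> - point_mass \<alpha> a \<phi>) \<le> C * \<rho> ^ n))"
\<comment> \<open>The maximum with 1/2 keeps the witness positive, as \<open>rate\<close> is 0 when
  \<open>lam\<close> is 0.\<close>
proof (rule exI[of _ "max rate (1/2)"], intro conjI ballI impI)
  fix \<mu> assume "\<mu> \<in> distributions \<alpha>" and one: "\<mu> (\<lambda>_. 1) = 1"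
  then have \<mu>: "holder_functional \<alpha> \<mu>"
    by (simp add: distributions_iff)
  obtain K where K: "0 \<le> K" "\<And>\<phi>. \<phi> \<in> holder_space \<alpha> \<Longrightarrow> norm (\<mu> \<phi>) \<le> K * holder_norm \<alpha> \<phi>"
    using holder_functional_bound[OF \<alpha>_pos \<mu>] by blast
  have "distribution_norm \<alpha> (\<lambda>\<phi>. (transfer_operator \<alpha> T ^^ n) \<mu> \<phi> - point_mass \<alpha> a \<phi>) \<le>
      2 * K * max rate (1/2) ^ n" for n
  proof (rule distribution_norm_le[OF \<alpha>_pos])
    fix \<phi> assume \<phi>: "\<phi> \<in> holder_space \<alpha>"
    have "(transfer_operator \<alpha> T ^^ n) \<mu> \<phi> - point_mass \<alpha> a \<phi> = remainder \<mu> n \<phi>"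
      using \<phi> one
      by (simp add: transfer_operator_funpow point_mass_eq[OF \<alpha>_pos fixpoint_in] remainder_def)
    also have "\<dots> \<le> 2 * K * holder_norm \<alpha> \<phi> * rate ^ n"
      using norm_remainder_le[OF \<mu> K(1) \<phi> K(2), of n] by simp
    also have "\<dots> \<le> 2 * K * holder_norm \<alpha> \<phi> * max rate (1/2) ^ n"
      using rate_nonneg K(1) holder_norm_nonneg[OF \<alpha>_pos \<phi>]
      by (intro mult_left_mono power_mono) auto
    finally show "(transfer_operator \<alpha> T ^^ n) \<mu> \<phi> - point_mass \<alpha> a \<phi> \<le>
        2 * K * max rate (1/2) ^ n * holder_norm \<alpha> \<phi>"
      by (simp add: ac_simps)
  qed (use K(1) in simp)
  then show "\<exists>C. \<forall>n. distribution_norm \<alpha>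
      (\<lambda>\<phi>. (transfer_operator \<alpha> T ^^ n) \<mu> \<phi> - point_mass \<alpha> a \<phi>) \<le> C * max rate (1/2) ^ n"
    by blast
qed (use rate_less_1 in auto)

end

theorem theorem1p1:
  fixes T T' :: "real \<Rightarrow> real" and lam a \<alpha> :: real
  assumes T_maps: "T ` {0..1} \<subseteq> {0..1}"
    and T_deriv: "\<And>x. x \<in> {0..1} \<Longrightarrow> (T has_real_derivative T' x) (at x within {0..1})"
    and T'_cont: "continuous_on {0..1} T'"
    and T'_bound: "\<And>x. x \<in> {0..1} \<Longrightarrow> \<bar>T' x\<bar> \<le> lam"
    and lam: "lam < 1"
    and a_fix: "a = (THE x. x \<in> {0..1} \<and> T x = x)"
    and \<alpha>: "0 < \<alpha>" "\<alpha> < 1"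
  shows "spectral_gap (distributions \<alpha>) (distribution_norm \<alpha>) (transfer_operator \<alpha> T) \<and>
    {\<mu> \<in> distributions \<alpha>. transfer_operator \<alpha> T \<mu> = \<mu>} = range (\<lambda>c \<phi>. c * point_mass \<alpha> a \<phi>) \<and>
    (\<exists>\<rho>. 0 < \<rho> \<and> \<rho> < 1 \<and>
      (\<forall>\<mu>\<in>distributions \<alpha>. \<mu> (\<lambda>_. 1) = 1 \<longrightarrow>
        (\<exists>C. \<forall>n. distribution_norm \<alpha>
          (\<lambda>\<phi>. (transfer_operator \<alpha> T ^^ n) \<mu> \<phi> - point_mass \<alpha> a \<phi>) \<le> C * \<rho> ^ n)))"
proof -
  \<comment> \<open>Mean value inequality on the convex interval, with derivatives taken within
    it.\<close>
  have lip: "\<bar>T x - T y\<bar> \<le> lam * \<bar>x - y\<bar>" if "x \<in> unit_I" "y \<in> unit_I" for x y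
    using field_differentiable_bound[of unit_I T T' lam x y] T_deriv T'_bound that by simp
  have lam_nonneg: "0 \<le> lam"
    using T'_bound[of 0] by simp
  \<comment> \<open>Existence and uniqueness together make the definite description of
    \<open>a\<close> denote the fixed point.\<close>
  have "\<exists>!x. x \<in> unit_I \<and> T x = x"
    using T_maps lam lam_nonneg lip
    by (intro Banach_fix[where c = lam]) (auto simp: complete_eq_closed dist_real_def)
  then have "a \<in> unit_I \<and> T a = a"
    unfolding a_fix by (rule theI')
  then interpret holder_contraction T lam a \<alpha>
    using T_maps lam lam_nonneg lip \<alpha> by unfold_locales auto
  show ?thesis
    unfolding spectral_gap_def
    using simple_eigenvalue_1 rate_nonneg rate_less_1 spectrum_subset invariant_distributions
      exponential_convergence
    by blast
qed

end
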